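(* Let $\langle\phi,\vec a\rangle$ be a loop with $\phi(\vec x)\equiv\bigwedge_{i=1}^k C_i$ in CNF, where each clause $C_i$ contains an inequation $e_i(\vec x)>0$ (as one of its disjuncts) such that \[ e_i(\vec x)\ge e_i(\vec a(\vec x))\implies e_i(\vec a(\vec x))\ge e_i(\vec a^2(\vec x)) \] is valid. Then the formula \[ \vec x'=\vec a^n(\vec x)\land\bigwedge_{i=1}^k\bigl(e_i(\vec x)>0\land e_i(\vec a^{n-1}(\vec x))>0\bigr) \] approximates $\langle\phi,\vec a\rangle$. If moreover $C_i\equiv e_i>0$ for all $i\in[1,k]$, then this formula is equivalent to $\langle\phi,\vec a\rangle$.
   Context: Fix $d\ge 1$, integer variables $\vec x=(x_1,\dots,x_d)$, $\vec x'$, and $n$ ranging over $\mathbb N$. A loop $\langle\phi,\vec a\rangle$ consists of a quantifier-free formula $\phi$ over atoms $p>0$ ($p$ an arithmetic expression over $\vec x$, integer semantics) and a map $\vec a:\mathbb Z^d\to\mathbb Z^d$ given by expressions over $\vec x$; $\vec a^m$ is $m$-fold application. $\vec x\longrightarrow_{\langle\phi,\vec a\rangle}\vec x'$ iff $\phi(\vec x)\land\vec x'=\vec a(\vec x)$, and $\longrightarrow^m$ is its $m$-fold composition. A formula $\psi$ over $(\vec x,n,\vec x')$ approximates the loop if for all $\vec x,\vec x'\in\mathbb Z^d$ and $n>0$, $\psi$ implies $\vec x\longrightarrow^n_{\langle\phi,\vec a\rangle}\vec x'$; it is equivalent to the loop if moreover the converse implication holds. Validity means truth for all integer values of the free variables.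 *)

theory Defs
  imports "HOL-Analysis.Finite_Cartesian_Product"
begin

text \<open>
  The dimension \<open>d \<ge> 1\<close> is the cardinality of the index type \<open>'d\<close>. An expression is
  represented by its meaning as an integer-valued function of the variables, so that no
  particular set of arithmetic operators is singled out. Propositional structure is syntactic.
\<close>

type_synonym 'd expr = "int ^ 'd \<Rightarrow> int"

datatype 'd formula =
    Gt0 "'d expr"
  | Neg "'d formula"
  | Conj "'d formula list"
  | Disj "'d formula list"

fun holds :: "('d::finite) formula \<Rightarrow> int ^ 'd \<Rightarrow> bool" where
  "holds (Gt0 p) x \<longleftrightarrow> p x > 0"
| "holds (Neg f) x \<longleftrightarrow> \<not> holds f x"
| "holds (Conj fs) x \<longleftrightarrow> (\<forall>f\<in>set fs. holds f x)"
| "holds (Disj fs) x \<longleftrightarrow> (\<exists>f\<in>set fs. holds f x)"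

definition equiv_formula :: "('d::finite) formula \<Rightarrow> 'd formula \<Rightarrow> bool"  (infix "\<simeq>" 50) where
  "f \<simeq> g \<longleftrightarrow> (\<forall>x. holds f x \<longleftrightarrow> holds g x)"

definition is_literal :: "('d::finite) formula \<Rightarrow> bool" where
  "is_literal f \<longleftrightarrow> (\<exists>p. f = Gt0 p \<or> f = Neg (Gt0 p))"

text \<open>A literal standing alone counts as a clause with a single disjunct.\<close>

fun disjuncts :: "('d::finite) formula \<Rightarrow> 'd formula set" where
  "disjuncts (Disj fs) = set fs"
| "disjuncts f = {f}"

definition is_clause :: "('d::finite) formula \<Rightarrow> bool" where
  "is_clause f \<longleftrightarrow> (\<forall>l\<in>disjuncts f. is_literal l)"

type_synonym 'd loop = "'d formula \<times> (int ^ 'd \<Rightarrow> int ^ 'd)"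

definition step :: "('d::finite) loop \<Rightarrow> int ^ 'd \<Rightarrow> int ^ 'd \<Rightarrow> bool" where
  "step L x x' \<longleftrightarrow> holds (fst L) x \<and> x' = snd L x"

text \<open>A formula over \<open>(x, n, x')\<close> is given by its truth value.\<close>

definition approximates :: "(int ^ 'd \<Rightarrow> nat \<Rightarrow> int ^ 'd \<Rightarrow> bool) \<Rightarrow> ('d::finite) loop \<Rightarrow> bool" where
  "approximates \<psi> L \<longleftrightarrow> (\<forall>x x' n. n > 0 \<longrightarrow> \<psi> x n x' \<longrightarrow> (step L ^^ n) x x')"

definition equivalent_to_loop :: "(int ^ 'd \<Rightarrow> nat \<Rightarrow> int ^ 'd \<Rightarrow> bool) \<Rightarrow> ('d::finite) loop \<Rightarrow> bool" where
  "equivalent_to_loop \<psi> L \<longleftrightarrow>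
     approximates \<psi> L \<and> (\<forall>x x' n. n > 0 \<longrightarrow> (step L ^^ n) x x' \<longrightarrow> \<psi> x n x')"

end

theory Submission
  imports Defs
begin

text \<open>
  Along an orbit the sequence \<open>e (a\<^sup>m x)\<close> can never increase again once it has failed to
  increase strictly, so it is unimodal and its minimum over \<open>0 \<le> m < n\<close> is attained at an
  endpoint. Positivity of every \<open>e\<^sub>i\<close> at the first and the last guard evaluation therefore gives
  positivity at all of them.
\<close>

text \<open>Either \<open>f\<close> has not dropped below \<open>f 0\<close> by index
  \<open>m\<close>, or a step without increase has already occurred; by \<open>unimodal\<close> the
  latter persists, so \<open>f\<close> keeps descending from \<open>m\<close> to
  \<open>n\<close>.\<close>

lemma le_or_le_of_unimodal:
  fixes f :: "nat \<Rightarrow> 'a::linorder"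
  assumes unimodal: "\<And>m. f (Suc m) \<le> f m \<Longrightarrow> f (Suc (Suc m)) \<le> f (Suc m)"
    and "m \<le> n"
  shows "f 0 \<le> f m \<or> f n \<le> f m"
proof -
  have "f 0 \<le> f m \<or> f (Suc m) \<le> f m"
  proof (induction m)
    case (Suc m)
    then show ?case
      using unimodal[of m] by (meson le_cases order_trans)
  qed simp
  moreover have "f n \<le> f m" if "f (Suc m) \<le> f m"
  proof -
    \<comment> \<open>The second conjunct strengthens the induction: it is what
      \<open>unimodal\<close> passes on from one index to the next.\<close>
    from \<open>m \<le> n\<close> have "f n \<le> f m \<and> f (Suc n) \<le> f n"
    proof (induction n rule: dec_induct)
      case base
      then show ?case using that by simp
    next
      case (step n)
      then show ?case using unimodal[of n] by auto
    qed
    then show ?thesis ..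
  qed
  ultimately show ?thesis by blast
qed

text \<open>A step is deterministic, so a run can only follow the orbit of \<open>x\<close>; what
  remains are the guards, tested before each step and hence not in the final state.\<close>

lemma relpowp_step_iff:
  "(step L ^^ n) x x' \<longleftrightarrow> x' = (snd L ^^ n) x \<and> (\<forall>m<n. holds (fst L) ((snd L ^^ m) x))"
proof (induction n arbitrary: x')
  case (Suc n)
  then show ?case
    by (auto simp: step_def OO_def less_Suc_eq)
qed auto

lemma holds_if_disjunct:
  assumes "g \<in> disjuncts f" "holds g x"
  shows "holds f x"
  using assms by (cases f) auto

theorem theorem10:
  fixes \<phi> :: "('d::finite) formula"
    and a :: "int ^ 'd \<Rightarrow> int ^ 'd"
    and k :: nat
    and C :: "nat \<Rightarrow> 'd formula"
    and e :: "nat \<Rightarrow> 'd expr"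
    and \<psi> :: "int ^ 'd \<Rightarrow> nat \<Rightarrow> int ^ 'd \<Rightarrow> bool"
  assumes cnf: "\<phi> \<simeq> Conj (map C [1..<Suc k])"
    and clauses: "\<forall>i\<in>{1..k}. is_clause (C i)"
    and contains: "\<forall>i\<in>{1..k}. Gt0 (e i) \<in> disjuncts (C i)"
    and decrease: "\<forall>i\<in>{1..k}. \<forall>x. e i x \<ge> e i (a x) \<longrightarrow> e i (a x) \<ge> e i ((a ^^ 2) x)"
    and psi: "\<psi> = (\<lambda>x n x'. x' = (a ^^ n) x \<and>
                (\<forall>i\<in>{1..k}. e i x > 0 \<and> e i ((a ^^ (n - 1)) x) > 0))"
  shows "approximates \<psi> (\<phi>, a) \<and>
         ((\<forall>i\<in>{1..k}. C i \<simeq> Gt0 (e i)) \<longrightarrow> equivalent_to_loop \<psi> (\<phi>, a))"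
proof -
  have \<phi>_iff: "holds \<phi> x \<longleftrightarrow> (\<forall>i\<in>{1..k}. holds (C i) x)" for x
    \<comment> \<open>Without \<open>upt_Suc\<close> the list stays an interval, whose set becomes
      \<open>{1..k}\<close>.\<close>
    using cnf by (simp add: equiv_formula_def atLeastLessThanSuc_atLeastAtMost del: upt_Suc)
  have approx: "approximates \<psi> (\<phi>, a)"
    unfolding approximates_def relpowp_step_iff
  proof (intro allI impI conjI)
    fix x x' and n m :: nat
    assume "\<psi> x n x'"
    then have ends: "e i x > 0" "e i ((a ^^ (n - 1)) x) > 0" if "i \<in> {1..k}" for i
      using that by (auto simp: psi)
    from \<open>\<psi> x n x'\<close> show "x' = (snd (\<phi>, a) ^^ n) x"
      by (simp add: psi)
    assume "m < n"
    have "holds (C i) ((a ^^ m) x)" if i: "i \<in> {1..k}" for i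
    proof -
      \<comment> \<open>The right endpoint is \<open>n - 1\<close>, the last index at which the
        guard is tested.\<close>
      have "e i ((a ^^ 0) x) \<le> e i ((a ^^ m) x) \<or> e i ((a ^^ (n - 1)) x) \<le> e i ((a ^^ m) x)"
      proof (rule le_or_le_of_unimodal)
        show "e i ((a ^^ Suc (Suc j)) x) \<le> e i ((a ^^ Suc j) x)"
          if "e i ((a ^^ Suc j) x) \<le> e i ((a ^^ j) x)" for j
          \<comment> \<open>This is \<open>decrease\<close> at the state
            \<open>(a ^^ j) x\<close>.\<close>
          using decrease i that by (simp add: numeral_2_eq_2)
        show "m \<le> n - 1"
          using \<open>m < n\<close> by simp
      qed
      with ends[OF i] have "holds (Gt0 (e i)) ((a ^^ m) x)"
        by auto
      with contains i show ?thesis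
        by (blast intro: holds_if_disjunct)
    qed
    then show "holds (fst (\<phi>, a)) ((snd (\<phi>, a) ^^ m) x)"
      by (simp add: \<phi>_iff)
  qed
  moreover have "equivalent_to_loop \<psi> (\<phi>, a)" if C: "\<forall>i\<in>{1..k}. C i \<simeq> Gt0 (e i)"
    unfolding equivalent_to_loop_def relpowp_step_iff
  proof (intro conjI allI impI approx)
    fix x x' and n :: nat
    assume "n > 0"
      and run: "x' = (snd (\<phi>, a) ^^ n) x \<and> (\<forall>m<n. holds (fst (\<phi>, a)) ((snd (\<phi>, a) ^^ m) x))"
    have "e i ((a ^^ m) x) > 0" if "i \<in> {1..k}" "m < n" for i m
      using run C that by (simp add: \<phi>_iff equiv_formula_def)
    \<comment> \<open>Both endpoints \<open>0\<close> and \<open>n - 1\<close> lie below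
      \<open>n\<close> because \<open>n > 0\<close>.\<close>
    from this[of _ 0] this[of _ "n - 1"] run \<open>n > 0\<close> show "\<psi> x n x'"
      by (simp add: psi)
  qed
  ultimately show ?thesis by blast
qed

end
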